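(* Let $R$ be a unique factorization domain with quotient field $Q(R)$, let $f(s)=\frac{a_m}{m^s}+\cdots+\frac{a_n}{n^s}$ be an algebraically primitive Dirichlet polynomial with coefficients in $R$, $a_ma_n\ne0$ and $\gcd(m,n)=1$, let $p_1,\dots,p_t$ be prime elements of $R$, and let $q_1,\dots,q_k$ be all the prime factors of $m\cdot n$. If (i) $\nu_{p_j}(a_m)\neq\nu_{p_j}(a_n)$ for $j=1,\dots,t$, (ii) $\left(\frac ni\right)^{\nu_{p_j}(a_i)-\nu_{p_j}(a_m)}>\left(\frac mi\right)^{\nu_{p_j}(a_i)-\nu_{p_j}(a_n)}$ for $m<i<n$ and $j=1,\dots,t$, (iii) $\gcd(\nu_{p_1}(a_n)-\nu_{p_1}(a_m),\dots,\nu_{p_t}(a_n)-\nu_{p_t}(a_m),\ \nu_{q_1}(n)-\nu_{q_1}(m),\dots,\nu_{q_k}(n)-\nu_{q_k}(m))=1$, then $f$ is irreducible over $Q(R)$.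
   Context: Dirichlet polynomials are multiplied by the Dirichlet product $\left(\sum_j\frac{b_j}{j^s}\right)\left(\sum_k\frac{c_k}{k^s}\right)=\sum_i\frac{\sum_{jk=i}b_jc_k}{i^s}$; constant means supported on $\{1\}$; algebraically primitive means the indices with nonzero coefficient have gcd $1$. $\nu_p$ is the $p$-adic valuation with $\nu_p(0)=+\infty$. Irreducible over $Q(R)$: not a product of two nonconstant Dirichlet polynomials with coefficients in $Q(R)$. *)

theory Defs
  imports Complex_Main
    "HOL-Computational_Algebra.Computational_Algebra"
    "HOL-Library.Extended_Real"
begin

text \<open>
  A Dirichlet polynomial \<open>\<Sum>\<^sub>i a\<^sub>i / i\<^sup>s\<close> is represented by its coefficient function \<open>i \<mapsto> a\<^sub>i\<close>.
  The indices are the positive integers, so the value at \<open>0\<close> is required to be \<open>0\<close>.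
\<close>

definition dirichlet_poly :: "(nat \<Rightarrow> 'a::zero) \<Rightarrow> bool" where
  "dirichlet_poly f \<longleftrightarrow> f 0 = 0 \<and> finite {i. f i \<noteq> 0}"

definition dirichlet_prod :: "(nat \<Rightarrow> 'a::comm_semiring_0) \<Rightarrow> (nat \<Rightarrow> 'a) \<Rightarrow> nat \<Rightarrow> 'a" where
  "dirichlet_prod b c i = (if i = 0 then 0 else (\<Sum>(j, k) \<in> {(j, k). j * k = i}. b j * c k))"

definition dirichlet_const :: "(nat \<Rightarrow> 'a::zero) \<Rightarrow> bool" where
  "dirichlet_const f \<longleftrightarrow> {i. f i \<noteq> 0} \<subseteq> {1}"

definition alg_primitive :: "(nat \<Rightarrow> 'a::zero) \<Rightarrow> bool" where
  "alg_primitive f \<longleftrightarrow> Gcd {i. f i \<noteq> 0} = 1"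

definition dirichlet_irreducible :: "(nat \<Rightarrow> 'k::field) \<Rightarrow> bool" where
  "dirichlet_irreducible f \<longleftrightarrow>
     \<not> (\<exists>g h. dirichlet_poly g \<and> dirichlet_poly h \<and>
             \<not> dirichlet_const g \<and> \<not> dirichlet_const h \<and> f = dirichlet_prod g h)"

definition irreducible_over_Q :: "(nat \<Rightarrow> 'a::idom) \<Rightarrow> bool" where
  "irreducible_over_Q f \<longleftrightarrow> dirichlet_irreducible (\<lambda>i. to_fract (f i))"

text \<open>
  The valuation with \<open>\<nu>\<^sub>p(0) = \<infinity>\<close>; the library's \<^const>\<open>multiplicity\<close> is \<open>0\<close> at \<open>0\<close>.
\<close>

definition nu :: "'a::factorial_semiring \<Rightarrow> 'a \<Rightarrow> ereal" where
  "nu p x = (if x = 0 then \<infinity> else ereal (real (multiplicity p x)))"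

text \<open>
  Real powers extended to infinite exponents by the limits of \<open>b\<^sup>x\<close> as \<open>x \<rightarrow> \<plusminus>\<infinity>\<close>.
  Meaningful for \<open>b > 0\<close> only.
\<close>

definition epowr :: "real \<Rightarrow> ereal \<Rightarrow> ereal" where
  "epowr b e =
     (if e = \<infinity> then (if b > 1 then \<infinity> else if b = 1 then 1 else 0)
      else if e = -\<infinity> then (if b > 1 then 0 else if b = 1 then 1 else \<infinity>)
      else ereal (b powr real_of_ereal e))"

end

theory Submission
  imports Defs
begin

text \<open>
  For a prime \<open>p\<close> and a slope \<open>s\<close>, the weight \<open>\<nu>\<^sub>p(a\<^sub>i) - s ln i\<close> is a valuation for the Dirichlet
  product, so its minimum over the support is additive (Gauss's lemma). Hypothesis (ii) says that
  the points \<open>(ln i, \<nu>\<^sub>p(a\<^sub>i))\<close> lie above the segment joining the extreme ones; taking for \<open>s\<close> the slope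
  of that segment, the minimum for \<open>f\<close> is attained at both ends, hence so is the minimum for
  each factor. A factor with extreme indices \<open>m'\<close> and \<open>n'\<close> therefore has the same slope
  for each \<open>p\<^sub>j\<close>, so that
  \<open>ln (n'/m') / ln (n/m)\<close> is a rational number \<open>r\<close> for which \<open>r x\<close> is an integer for each of the
  integers \<open>x\<close> in (iii). Their gcd being \<open>1\<close>, \<open>r\<close> is an integer in \<open>[0, 1]\<close>, and one of the factors
  has a single term, at an index dividing both \<open>m\<close> and \<open>n\<close>.
\<close>

section \<open>Single coefficients of Dirichlet products\<close>

lemma dirichlet_prod_split:
  fixes g h :: "nat \<Rightarrow> 'a::comm_semiring_0"
  assumes "i * j \<noteq> 0"
  shows "dirichlet_prod g h (i * j) =
    g i * h j + (\<Sum>(k, l) \<in> {(k, l). k * l = i * j} - {(i, j)}. g k * h l)"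
proof -
  \<comment> \<open>A sum over an infinite set would be 0 by convention. Since \<open>i * j\<close>
    is nonzero, its divisors are bounded by it, which makes the index set finite.\<close>
  have "{(k, l). k * l = i * j} \<subseteq> {..i * j} \<times> {..i * j}"
  proof
    fix x assume "x \<in> {(k, l). k * l = i * j}"
    then have "fst x dvd i * j" "snd x dvd i * j"
      by (auto dest: sym)
    then show "x \<in> {..i * j} \<times> {..i * j}"
      using assms by (auto simp: mem_Times_iff intro!: dvd_imp_le)
  qed
  then have "finite {(k, l). k * l = i * j}"
    by (rule finite_subset) auto
  from sum.remove[OF this, of "(i, j)" "\<lambda>(k, l). g k * h l"] show ?thesis
    using assms by (simp add: dirichlet_prod_def)
qed

lemma dirichlet_prod_nonzeroD:
  assumes "dirichlet_prod g h i \<noteq> 0"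
  obtains j k where "i = j * k" "g j \<noteq> 0" "h k \<noteq> 0"
proof -
  have "(\<Sum>(j, k) \<in> {(j, k). j * k = i}. g j * h k) \<noteq> 0"
    using assms by (auto simp: dirichlet_prod_def split: if_splits)
  then obtain x where "x \<in> {(j, k). j * k = i}" "(case x of (j, k) \<Rightarrow> g j * h k) \<noteq> 0"
    by (rule sum.not_neutral_contains_not_neutral)
  then show ?thesis
    by (intro that[of "fst x" "snd x"]) (auto split: prod.splits)
qed

text \<open>Multiplication is strictly monotone on positive integers, so two distinct pairs with the
  same nonzero product are never comparable componentwise. This excludes the competing terms at the
  extreme indices and at the minimizers of the weight.\<close>

lemma pair_less_cases:
  fixes i j k l :: nat
  assumes "k * l = i * j" "i * j \<noteq> 0" "(k, l) \<noteq> (i, j)"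
  shows "k < i \<or> l < j" "i < k \<or> j < l"
proof -
  have *: "a = c \<and> b = d" if "a * b = c * d" "c \<le> a" "d \<le> b" "c * d \<noteq> 0" for a b c d :: nat
  proof -
    have "c * b \<le> a * b" "c * d \<le> c * b"
      using that(2,3) by simp_all
    then have "c * b = a * b" "c * d = c * b"
      using that by linarith+
    then show ?thesis
      using that(3,4) by (metis le_zero_eq mult_cancel1 mult_cancel2 mult_is_0)
  qed
  show "k < i \<or> l < j"
    using *[of k l i j] assms by fastforce
  show "i < k \<or> j < l"
    using *[of i j k l] assms by fastforce
qed

lemma dirichlet_prod_least:
  fixes g h :: "nat \<Rightarrow> 'a::comm_semiring_0"
  assumes "i * j \<noteq> 0" "\<And>k. g k \<noteq> 0 \<Longrightarrow> i \<le> k" "\<And>k. h k \<noteq> 0 \<Longrightarrow> j \<le> k"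
  shows "dirichlet_prod g h (i * j) = g i * h j"
proof -
  have "(\<Sum>(k, l) \<in> {(k, l). k * l = i * j} - {(i, j)}. g k * h l) = 0"
  proof (rule sum.neutral, rule ballI)
    fix x assume "x \<in> {(k, l). k * l = i * j} - {(i, j)}"
    then obtain k l where x: "x = (k, l)" and "k * l = i * j" "(k, l) \<noteq> (i, j)"
      by auto
    then have "k < i \<or> l < j"
      using assms(1) pair_less_cases by blast
    then have "g k = 0 \<or> h l = 0"
      using assms(2)[of k] assms(3)[of l] by fastforce
    then show "(case x of (k, l) \<Rightarrow> g k * h l) = 0"
      unfolding x by auto
  qed
  then show ?thesis
    using dirichlet_prod_split[OF assms(1), of g h] by simp
qed

lemma dirichlet_prod_greatest:
  fixes g h :: "nat \<Rightarrow> 'a::comm_semiring_0"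
  assumes "i * j \<noteq> 0" "\<And>k. g k \<noteq> 0 \<Longrightarrow> k \<le> i" "\<And>k. h k \<noteq> 0 \<Longrightarrow> k \<le> j"
  shows "dirichlet_prod g h (i * j) = g i * h j"
proof -
  have "(\<Sum>(k, l) \<in> {(k, l). k * l = i * j} - {(i, j)}. g k * h l) = 0"
  proof (rule sum.neutral, rule ballI)
    fix x assume "x \<in> {(k, l). k * l = i * j} - {(i, j)}"
    then obtain k l where x: "x = (k, l)" and "k * l = i * j" "(k, l) \<noteq> (i, j)"
      by auto
    then have "i < k \<or> j < l"
      using assms(1) pair_less_cases by blast
    then have "g k = 0 \<or> h l = 0"
      using assms(2)[of k] assms(3)[of l] by fastforce
    then show "(case x of (k, l) \<Rightarrow> g k * h l) = 0"
      unfolding x by auto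
  qed
  then show ?thesis
    using dirichlet_prod_split[OF assms(1), of g h] by simp
qed

section \<open>Gauss's lemma for weights\<close>

lemma ex_first_minimizer:
  fixes w :: "nat \<Rightarrow> real"
  assumes "finite {i. P i}" "P i0"
  obtains i where "P i" "\<And>k. P k \<Longrightarrow> w i \<le> w k" "\<And>k. P k \<Longrightarrow> k < i \<Longrightarrow> w i < w k"
proof -
  define S where "S = {i. P i}"
  have S: "finite S" "S \<noteq> {}"
    using assms by (auto simp: S_def)
  \<comment> \<open>Ties between minimizers are broken towards the smallest index. The resulting
    strict inequality below that index singles out one dominating term in
    \<open>dirichlet_prod_gauss\<close>.\<close>
  define A where "A = {i \<in> S. w i = Min (w ` S)}"
  have "Min (w ` S) \<in> w ` S"
    using S by (intro Min_in) auto
  then have "A \<noteq> {}"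
    by (auto simp: A_def)
  moreover have "finite A"
    using S by (simp add: A_def)
  ultimately have "Min A \<in> A" and le: "\<And>k. k \<in> A \<Longrightarrow> Min A \<le> k"
    by auto
  then have *: "Min A \<in> S" "w (Min A) = Min (w ` S)"
    by (auto simp: A_def)
  have **: "w (Min A) \<le> w k" if "k \<in> S" for k
    using that S by (simp add: *)
  have "w (Min A) < w k" if "k \<in> S" "k < Min A" for k
  proof -
    have "w k \<noteq> w (Min A)"
      using le[of k] that * by (auto simp: A_def)
    with **[OF that(1)] show ?thesis
      by simp
  qed
  with * ** show ?thesis
    by (intro that[of "Min A"]) (auto simp: S_def)
qed

text \<open>The equality case of the ultrametric inequality. The condition on \<open>y\<close> is a
  divisibility because \<open>multiplicity p 0\<close> is 0, while \<open>y\<close> may well vanish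
  here.\<close>

lemma multiplicity_add_power_Suc_dvd:
  fixes x y :: "'a::{factorial_semiring, idom}"
  assumes "prime_elem p" "x \<noteq> 0" "p ^ Suc (multiplicity p x) dvd y"
  shows "x + y \<noteq> 0" "multiplicity p (x + y) = multiplicity p x"
proof -
  have "\<not> is_unit p"
    using assms(1) by auto
  then have nd: "\<not> p ^ Suc (multiplicity p x) dvd x"
    using assms(2) by (simp add: power_dvd_iff_le_multiplicity del: power_Suc)
  have "p ^ multiplicity p x dvd y"
    using assms(3) by (rule power_le_dvd) simp
  then have d: "p ^ multiplicity p x dvd x + y"
    by (intro dvd_add multiplicity_dvd)
  have nd': "\<not> p ^ Suc (multiplicity p x) dvd x + y"
    using nd assms(3) dvd_add_left_iff by blast
  then show "x + y \<noteq> 0"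
    by auto
  show "multiplicity p (x + y) = multiplicity p x"
    using d nd' by (rule multiplicity_eqI)
qed

text \<open>This is the intercept of the line of slope \<open>s\<close> through the point (ln i,
  multiplicity of the coefficient); its minimum over the support belongs to the supporting line of
  that slope of the Newton polygon. It is meaningful only where \<open>f i\<close> is
  nonzero.\<close>

definition weight :: "real \<Rightarrow> 'a::factorial_semiring \<Rightarrow> (nat \<Rightarrow> 'a) \<Rightarrow> nat \<Rightarrow> real" where
  "weight s p f i = real (multiplicity p (f i)) - s * ln (real i)"

text \<open>Let \<open>i\<close> and \<open>j\<close> be the first minimizers. Every other pair with
  the same product has one component below its minimizer, so its total weight is strictly larger.
  Hence \<open>g i * h j\<close> has strictly smaller valuation than all other nonzero terms of its
  coefficient and determines the valuation of the sum.\<close>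

lemma dirichlet_prod_gauss:
  fixes g h :: "nat \<Rightarrow> 'a::{factorial_semiring, idom}"
  assumes p: "prime_elem p"
    and g: "dirichlet_poly g" "g i0 \<noteq> 0"
    and h: "dirichlet_poly h" "h j0 \<noteq> 0"
  obtains i j where "g i \<noteq> 0" "h j \<noteq> 0"
    "dirichlet_prod g h (i * j) \<noteq> 0"
    "weight s p (dirichlet_prod g h) (i * j) = weight s p g i + weight s p h j"
    "\<And>k. g k \<noteq> 0 \<Longrightarrow> weight s p g i \<le> weight s p g k"
    "\<And>k. h k \<noteq> 0 \<Longrightarrow> weight s p h j \<le> weight s p h k"
proof -
  have fin: "finite {i. g i \<noteq> 0}" "finite {i. h i \<noteq> 0}"
    using g(1) h(1) by (simp_all add: dirichlet_poly_def)
  obtain i where i: "g i \<noteq> 0" "\<And>k. g k \<noteq> 0 \<Longrightarrow> weight s p g i \<le> weight s p g k"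
      "\<And>k. g k \<noteq> 0 \<Longrightarrow> k < i \<Longrightarrow> weight s p g i < weight s p g k"
    by (rule ex_first_minimizer[where w = "weight s p g", OF fin(1) g(2)]) blast
  obtain j where j: "h j \<noteq> 0" "\<And>k. h k \<noteq> 0 \<Longrightarrow> weight s p h j \<le> weight s p h k"
      "\<And>k. h k \<noteq> 0 \<Longrightarrow> k < j \<Longrightarrow> weight s p h j < weight s p h k"
    by (rule ex_first_minimizer[where w = "weight s p h", OF fin(2) h(2)]) blast
  have pos: "0 < k" if "g k \<noteq> 0 \<or> h k \<noteq> 0" for k
    using that g h by (cases k) (auto simp: dirichlet_poly_def)
  have ij: "i * j \<noteq> 0"
    using pos[of i] pos[of j] i j by simp
  define r where "r = (\<Sum>(k, l) \<in> {(k, l). k * l = i * j} - {(i, j)}. g k * h l)"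
  have "p ^ Suc (multiplicity p (g i * h j)) dvd r"
    unfolding r_def
  proof (rule dvd_sum)
    fix x assume "x \<in> {(k, l). k * l = i * j} - {(i, j)}"
    then obtain k l where x: "x = (k, l)" and kl: "k * l = i * j" "(k, l) \<noteq> (i, j)"
      by auto
    have "p ^ Suc (multiplicity p (g i * h j)) dvd g k * h l"
    proof (cases "g k = 0 \<or> h l = 0")
      case False
      then have "weight s p g i + weight s p h j < weight s p g k + weight s p h l"
        using pair_less_cases(1)[OF kl(1) ij kl(2)] i(2,3)[of k] j(2,3)[of l] by fastforce
      \<comment> \<open>Both pairs have the same product, so the logarithmic parts of the weights
        cancel and the strict inequality passes to the multiplicities.\<close>
      moreover have "ln (real k) + ln (real l) = ln (real i) + ln (real j)"
      proof -
        have "ln (real k) + ln (real l) = ln (real (k * l))"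
          using False pos[of k] pos[of l] by (simp add: ln_mult)
        also have "\<dots> = ln (real i) + ln (real j)"
          using i j pos[of i] pos[of j] unfolding kl(1) by (simp add: ln_mult)
        finally show ?thesis .
      qed
      then have "s * ln (real k) + s * ln (real l) = s * ln (real i) + s * ln (real j)"
        by (metis distrib_left)
      ultimately have "multiplicity p (g i * h j) < multiplicity p (g k * h l)"
        using False i j p unfolding weight_def by (simp add: prime_elem_multiplicity_mult_distrib)
      then show ?thesis
        by (intro multiplicity_dvd') simp
    qed auto
    then show "p ^ Suc (multiplicity p (g i * h j)) dvd (case x of (k, l) \<Rightarrow> g k * h l)"
      by (simp add: x)
  qed
  from multiplicity_add_power_Suc_dvd[OF p _ this] i j
  have *: "dirichlet_prod g h (i * j) \<noteq> 0"
    "multiplicity p (dirichlet_prod g h (i * j)) = multiplicity p (g i * h j)"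
    using dirichlet_prod_split[OF ij, of g h] by (simp_all add: r_def)
  have "weight s p (dirichlet_prod g h) (i * j) = weight s p g i + weight s p h j"
    using * i j p pos[of i] pos[of j] unfolding weight_def
    by (simp add: prime_elem_multiplicity_mult_distrib ln_mult algebra_simps)
  with that[of i j] * i j show ?thesis
    by blast
qed

section \<open>Passing from the quotient field to the ring\<close>

lemma fract_common_denominator:
  fixes g :: "nat \<Rightarrow> 'a::idom fract"
  assumes "dirichlet_poly g"
  obtains c G where "c \<noteq> 0" "dirichlet_poly G" "\<And>i. to_fract (G i) = to_fract c * g i"
proof -
  have "\<exists>c. c \<noteq> 0 \<and> (\<forall>i\<in>S. \<exists>y. to_fract y = to_fract c * g i)" if "finite S" for S
    using that
  proof (induction S rule: finite_induct)
    case empty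
    show ?case by (intro exI[of _ 1]) auto
  next
    case (insert j S)
    then obtain c where c: "c \<noteq> 0" "\<forall>i\<in>S. \<exists>y. to_fract y = to_fract c * g i"
      by blast
    obtain a b where ab: "g j = Fract a b" "b \<noteq> 0"
      by (cases "g j") auto
    have "\<exists>y. to_fract y = to_fract (b * c) * g i" if "i \<in> insert j S" for i
    proof (cases "i = j")
      case True
      have "to_fract (a * c) = to_fract (b * c) * g j"
        using ab by (simp add: to_fract_def eq_fract algebra_simps)
      with True show ?thesis by blast
    next
      case False
      with that have "i \<in> S"
        by simp
      with c(2) obtain y where "to_fract y = to_fract c * g i"
        by blast
      then have "to_fract (b * y) = to_fract (b * c) * g i"
        by (simp add: mult.assoc)
      then show ?thesis by blast
    qed
    moreover have "b * c \<noteq> 0"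
      using ab c by simp
    ultimately show ?case by blast
  qed
  from this[of "{i. g i \<noteq> 0}"] obtain c
    where c: "c \<noteq> 0" "\<forall>i\<in>{i. g i \<noteq> 0}. \<exists>y. to_fract y = to_fract c * g i"
    using assms by (auto simp: dirichlet_poly_def)
  have "\<exists>y. to_fract y = to_fract c * g i" for i
    using c(2) by (cases "g i = 0") (auto intro!: exI[of _ 0])
  then obtain G where G: "\<And>i. to_fract (G i) = to_fract c * g i"
    by metis
  have "G i = 0 \<longleftrightarrow> g i = 0" for i
    using G[of i] c(1) by (metis mult_eq_0_iff to_fract_eq_0_iff)
  then have "dirichlet_poly G"
    using assms by (simp add: dirichlet_poly_def)
  with that[of c G] c G show ?thesis
    by blast
qed

lemma to_fract_dirichlet_prod:
  "to_fract (dirichlet_prod g h i) = dirichlet_prod (\<lambda>k. to_fract (g k)) (\<lambda>k. to_fract (h k)) i"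
  by (simp add: dirichlet_prod_def case_prod_unfold)

lemma dirichlet_prod_scale:
  "dirichlet_prod (\<lambda>k. c * g k) (\<lambda>k. d * h k) i = c * d * dirichlet_prod g h i"
  by (simp add: dirichlet_prod_def sum_distrib_left case_prod_unfold mult_ac)

text \<open>The price of moving the factors into the ring is the constant \<open>c\<close>. It
  shifts all valuations of the nonzero coefficients of \<open>a\<close> by the same amount, so
  differences of valuations do not see it.\<close>

lemma clear_denominators:
  fixes a :: "nat \<Rightarrow> 'a::idom"
  assumes "dirichlet_poly g" "dirichlet_poly h" "(\<lambda>i. to_fract (a i)) = dirichlet_prod g h"
  obtains c G H where "c \<noteq> 0" "dirichlet_poly G" "dirichlet_poly H"
    "\<And>i. G i = 0 \<longleftrightarrow> g i = 0" "\<And>i. H i = 0 \<longleftrightarrow> h i = 0"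
    "(\<lambda>i. c * a i) = dirichlet_prod G H"
proof -
  obtain c G where G: "c \<noteq> 0" "dirichlet_poly G" "\<And>i. to_fract (G i) = to_fract c * g i"
    using fract_common_denominator[OF assms(1)] by blast
  obtain d H where H: "d \<noteq> 0" "dirichlet_poly H" "\<And>i. to_fract (H i) = to_fract d * h i"
    using fract_common_denominator[OF assms(2)] by blast
  have "G i = 0 \<longleftrightarrow> g i = 0" "H i = 0 \<longleftrightarrow> h i = 0" for i
    using G(1,3) H(1,3) by (metis mult_eq_0_iff to_fract_eq_0_iff)+
  moreover have "(\<lambda>i. (c * d) * a i) = dirichlet_prod G H"
  proof
    fix i
    have "to_fract (dirichlet_prod G H i) = to_fract (c * d * a i)"
      using fun_cong[OF assms(3), of i]
      by (simp add: to_fract_dirichlet_prod G(3) H(3) dirichlet_prod_scale)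
    then show "c * d * a i = dirichlet_prod G H i"
      by (metis to_fract_eq_iff)
  qed
  ultimately show ?thesis
    using that[of "c * d" G H] G H by auto
qed

section \<open>Extreme indices and slopes of the factors\<close>

lemma support_extremes:
  assumes "dirichlet_poly g" "g i0 \<noteq> 0"
  obtains i j where "g i \<noteq> 0" "g j \<noteq> 0" "0 < i" "i \<le> j"
    "\<And>k. g k \<noteq> 0 \<Longrightarrow> i \<le> k" "\<And>k. g k \<noteq> 0 \<Longrightarrow> k \<le> j"
proof -
  let ?S = "{i. g i \<noteq> 0}"
  have S: "finite ?S" "?S \<noteq> {}" "0 \<notin> ?S"
    using assms by (auto simp: dirichlet_poly_def)
  then have "Min ?S \<in> ?S" "Max ?S \<in> ?S"
    using Min_in Max_in by blast+
  moreover have "Min ?S \<le> k" "k \<le> Max ?S" if "g k \<noteq> 0" for k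
    using that S by auto
  ultimately show ?thesis
    using S by (intro that[of "Min ?S" "Max ?S"]) (auto intro: gr0I)
qed

text \<open>For nonzero coefficients the exponents in (ii) are finite, so both sides are ordinary
  positive real powers, and taking logarithms makes the condition linear in the valuations.\<close>

lemma nu_epowr_less_imp:
  fixes i m n :: nat
  assumes "epowr (real n / real i) (nu p x - nu p y) > epowr (real m / real i) (nu p x - nu p z)"
    and "x \<noteq> 0" "y \<noteq> 0" "z \<noteq> 0" "0 < m" "0 < i" "0 < n"
  shows "(real (multiplicity p x) - real (multiplicity p z)) * (ln (real m) - ln (real i))
    < (real (multiplicity p x) - real (multiplicity p y)) * (ln (real n) - ln (real i))"
proof -
  have "(real m / real i) powr (real (multiplicity p x) - real (multiplicity p z))
      < (real n / real i) powr (real (multiplicity p x) - real (multiplicity p y))"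
    using assms by (simp add: nu_def epowr_def)
  then have "ln ((real m / real i) powr (real (multiplicity p x) - real (multiplicity p z)))
      < ln ((real n / real i) powr (real (multiplicity p x) - real (multiplicity p y)))"
    using assms by (subst ln_less_cancel_iff) auto
  then show ?thesis
    using assms by (simp add: ln_powr ln_div)
qed

text \<open>Both ends of the product have the minimal weight, which is the sum of the minimal
  weights of \<open>g\<close> and \<open>h\<close>. At each end this weight is also the sum of the
  weights of the end terms of \<open>g\<close> and \<open>h\<close>, neither of which can lie below
  its minimum. So both are minimal, and the two ends of \<open>g\<close> have equal weight.\<close>

lemma factor_slope:
  fixes g h :: "nat \<Rightarrow> 'a::{factorial_semiring, idom}"
  assumes p: "prime_elem p"
    and g: "dirichlet_poly g" "g m1 \<noteq> 0" "g n1 \<noteq> 0"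
    and h: "dirichlet_poly h" "h m2 \<noteq> 0" "h n2 \<noteq> 0"
    and m: "dirichlet_prod g h (m1 * m2) = g m1 * h m2"
    and n: "dirichlet_prod g h (n1 * n2) = g n1 * h n2"
    and eq: "real (multiplicity p (g n1 * h n2)) - real (multiplicity p (g m1 * h m2)) =
      s * (ln (real (n1 * n2)) - ln (real (m1 * m2)))"
    and above: "\<And>i. dirichlet_prod g h i \<noteq> 0 \<Longrightarrow>
      s * (ln (real i) - ln (real (m1 * m2)))
        \<le> real (multiplicity p (dirichlet_prod g h i)) - real (multiplicity p (g m1 * h m2))"
  shows "real (multiplicity p (g n1)) - real (multiplicity p (g m1)) =
    s * (ln (real n1) - ln (real m1))"
proof -
  obtain i j where "g i \<noteq> 0" "h j \<noteq> 0" and ij: "dirichlet_prod g h (i * j) \<noteq> 0"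
    "weight s p (dirichlet_prod g h) (i * j) = weight s p g i + weight s p h j"
    "\<And>k. g k \<noteq> 0 \<Longrightarrow> weight s p g i \<le> weight s p g k"
    "\<And>k. h k \<noteq> 0 \<Longrightarrow> weight s p h j \<le> weight s p h k"
    by (rule dirichlet_prod_gauss[where s = s, OF p g(1,2) h(1,2)]) blast
  have pos: "0 < m1" "0 < n1" "0 < m2" "0 < n2"
    using g h by (auto simp: dirichlet_poly_def intro!: gr0I)
  have wm: "weight s p (dirichlet_prod g h) (m1 * m2) = weight s p g m1 + weight s p h m2"
    using m g h p pos
    by (simp add: weight_def prime_elem_multiplicity_mult_distrib ln_mult algebra_simps)
  have wn: "weight s p (dirichlet_prod g h) (n1 * n2) = weight s p g n1 + weight s p h n2"
    using n g h p pos
    by (simp add: weight_def prime_elem_multiplicity_mult_distrib ln_mult algebra_simps)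
  have "weight s p (dirichlet_prod g h) (n1 * n2) =
      weight s p (dirichlet_prod g h) (m1 * m2)"
    using eq unfolding weight_def m n by (simp add: algebra_simps)
  moreover have "weight s p (dirichlet_prod g h) (m1 * m2) \<le> weight s p (dirichlet_prod g h) (i * j)"
    using above[OF ij(1)] unfolding weight_def m by (simp add: algebra_simps)
  ultimately have "weight s p g n1 = weight s p g m1"
    using ij(2) ij(3)[OF g(2)] ij(3)[OF g(3)] ij(4)[OF h(2)] ij(4)[OF h(3)] wm wn by linarith
  then show ?thesis
    by (simp add: weight_def algebra_simps)
qed

text \<open>Exponentiating turns the relation between logarithms into an equality of two natural
  numbers, in which the exponents of \<open>q\<close> can be compared.\<close>

lemma multiplicity_diff_of_ln_ratio:
  fixes d e m n m' n' q :: nat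
  assumes "real d * (ln (real n') - ln (real m')) = real e * (ln (real n) - ln (real m))"
    and "0 < m" "0 < n" "0 < m'" "0 < n'" "prime q"
  shows "int d * (int (multiplicity q n') - int (multiplicity q m')) =
    int e * (int (multiplicity q n) - int (multiplicity q m))"
proof -
  have "ln (real (n' ^ d * m ^ e)) = ln (real (n ^ e * m' ^ d))"
    using assms by (simp add: ln_mult ln_realpow algebra_simps)
  then have "real (n' ^ d * m ^ e) = real (n ^ e * m' ^ d)"
    using assms by (subst (asm) ln_inj_iff) auto
  then have "n' ^ d * m ^ e = n ^ e * m' ^ d"
    by (simp only: of_nat_eq_iff)
  then have "multiplicity q (n' ^ d * m ^ e) = multiplicity q (n ^ e * m' ^ d)"
    by simp
  then have "d * multiplicity q n' + e * multiplicity q m = e * multiplicity q n + d * multiplicity q m'"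
    using assms by (simp add: prime_elem_multiplicity_mult_distrib prime_elem_multiplicity_power_distrib)
  then have "int (d * multiplicity q n' + e * multiplicity q m)
      = int (e * multiplicity q n + d * multiplicity q m')"
    by (simp only:)
  then show ?thesis
    by (simp add: algebra_simps)
qed

text \<open>The only possible index \<open>m1\<close> divides two coprime numbers, so it is
  1.\<close>

lemma dirichlet_const_single:
  fixes g h :: "nat \<Rightarrow> 'a::zero"
  assumes "\<And>k. g k \<noteq> 0 \<Longrightarrow> k = m1" "coprime (m1 * m2) (m1 * n2)"
  shows "dirichlet_const g"
proof -
  have "m1 = 1"
    using assms(2) by (metis coprime_def dvd_triv_left nat_dvd_1_iff_1)
  then show ?thesis
    using assms(1) by (fastforce simp: dirichlet_const_def)
qed

section \<open>Comparison of slopes in a hypothetical factorization\<close>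

theorem theorem5p3:
  fixes a :: "nat \<Rightarrow> 'a::{factorial_semiring, idom}"
    and p :: "nat \<Rightarrow> 'a"
    and m n t :: nat
  assumes "dirichlet_poly a"
    and "alg_primitive a"
    and "{i. a i \<noteq> 0} \<subseteq> {m..n}"
    and "a m * a n \<noteq> 0"
    and "coprime m n"
    and "t \<ge> 1"
    and "\<forall>j\<in>{1..t}. prime_elem (p j)"
    and "\<forall>j\<in>{1..t}. nu (p j) (a m) \<noteq> nu (p j) (a n)"
    and "\<forall>i j. m < i \<and> i < n \<and> j \<in> {1..t} \<longrightarrow>
           epowr (real n / real i) (nu (p j) (a i) - nu (p j) (a m))
             > epowr (real m / real i) (nu (p j) (a i) - nu (p j) (a n))"
    and "Gcd ((\<lambda>j. int (multiplicity (p j) (a n)) - int (multiplicity (p j) (a m))) ` {1..t}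
            \<union> (\<lambda>q. int (multiplicity q n) - int (multiplicity q m)) ` prime_factors (m * n)) = 1"
  shows "irreducible_over_Q a"
  unfolding irreducible_over_Q_def dirichlet_irreducible_def
proof (intro notI, elim exE conjE)
  fix g' h' :: "nat \<Rightarrow> 'a fract"
  assume g': "dirichlet_poly g'" "\<not> dirichlet_const g'"
    and h': "dirichlet_poly h'" "\<not> dirichlet_const h'"
    and "(\<lambda>i. to_fract (a i)) = dirichlet_prod g' h'"
  then obtain c g h where c: "c \<noteq> 0" and g: "dirichlet_poly g" and h: "dirichlet_poly h"
    and "\<And>i. g i = 0 \<longleftrightarrow> g' i = 0" "\<And>i. h i = 0 \<longleftrightarrow> h' i = 0"
    and "(\<lambda>i. c * a i) = dirichlet_prod g h"
    using clear_denominators by blast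
  then have nonconst: "\<not> dirichlet_const g" "\<not> dirichlet_const h"
    and gh: "\<And>i. dirichlet_prod g h i = c * a i"
    using g' h' by (simp_all add: dirichlet_const_def) metis
  have am: "a m \<noteq> 0" and an: "a n \<noteq> 0"
    using assms(4) by auto
  \<comment> \<open>Otherwise (i) would fail for the first prime, which exists as
    \<open>t \<ge> 1\<close>.\<close>
  have "m \<noteq> n"
    using assms(6,8) by auto
  then have m: "0 < m" and mn: "m < n"
    using assms(1,3) am by (auto simp: dirichlet_poly_def subset_iff intro!: gr0I)
  obtain m1 n1 where g1: "g m1 \<noteq> 0" "g n1 \<noteq> 0" "0 < m1" "m1 \<le> n1"
    "\<And>k. g k \<noteq> 0 \<Longrightarrow> m1 \<le> k" "\<And>k. g k \<noteq> 0 \<Longrightarrow> k \<le> n1"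
    using support_extremes[OF g] nonconst(1) unfolding dirichlet_const_def by blast
  obtain m2 n2 where h1: "h m2 \<noteq> 0" "h n2 \<noteq> 0" "0 < m2" "m2 \<le> n2"
    "\<And>k. h k \<noteq> 0 \<Longrightarrow> m2 \<le> k" "\<And>k. h k \<noteq> 0 \<Longrightarrow> k \<le> n2"
    using support_extremes[OF h] nonconst(2) unfolding dirichlet_const_def by blast
  have n12: "0 < n1" "0 < n2"
    using g1(3,4) h1(3,4) by simp_all
  have Pm: "dirichlet_prod g h (m1 * m2) = g m1 * h m2"
    using g1 h1 by (intro dirichlet_prod_least) auto
  have Pn: "dirichlet_prod g h (n1 * n2) = g n1 * h n2"
    using g1 h1 n12 by (intro dirichlet_prod_greatest) auto
  have supp: "m \<le> i \<and> i \<le> n" if "dirichlet_prod g h i \<noteq> 0" for i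
    using that assms(3) by (auto simp: gh)
  have m_eq: "m = m1 * m2"
  proof (rule antisym)
    show "m \<le> m1 * m2"
      using supp[of "m1 * m2"] Pm g1 h1 by simp
    obtain k l where "m = k * l" "g k \<noteq> 0" "h l \<noteq> 0"
      using dirichlet_prod_nonzeroD[of g h m] c am by (auto simp: gh)
    then show "m1 * m2 \<le> m"
      using g1(5) h1(5) by (simp add: mult_le_mono)
  qed
  have n_eq: "n = n1 * n2"
  proof (rule antisym)
    show "n1 * n2 \<le> n"
      using supp[of "n1 * n2"] Pn g1 h1 by simp
    obtain k l where "n = k * l" "g k \<noteq> 0" "h l \<noteq> 0"
      using dirichlet_prod_nonzeroD[of g h n] c an by (auto simp: gh)
    then show "n \<le> n1 * n2"
      using g1(6) h1(6) by (simp add: mult_le_mono)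
  qed
  \<comment> \<open>\<open>L\<close> and \<open>L1\<close> are the horizontal lengths of the
    segments of \<open>a\<close> and \<open>g\<close> on the logarithmic scale; \<open>D j\<close>
    and \<open>E j\<close> below are their heights at \<open>p j\<close>.\<close>
  define L where "L = ln (real n) - ln (real m)"
  define L1 where "L1 = ln (real n1) - ln (real m1)"
  have L: "0 < L"
    using m mn by (simp add: L_def)
  define D where "D j = int (multiplicity (p j) (a n)) - int (multiplicity (p j) (a m))" for j
  define E where "E j = int (multiplicity (p j) (g n1)) - int (multiplicity (p j) (g m1))" for j
  have slope: "of_int (E j) * L = of_int (D j) * L1" if j: "j \<in> {1..t}" for j
  proof -
    have p: "prime_elem (p j)"
      using assms(7) j by blast
    have mult: "multiplicity (p j) (dirichlet_prod g h i)
        = multiplicity (p j) c + multiplicity (p j) (a i)" if "a i \<noteq> 0" for i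
      using c that p by (simp add: gh prime_elem_multiplicity_mult_distrib)
    define s where "s = of_int (D j) / L"
    have sL: "s * L = of_int (D j)"
      using L by (simp add: s_def)
    have above: "s * (ln (real i) - ln (real m))
        \<le> real (multiplicity (p j) (a i)) - real (multiplicity (p j) (a m))" if i: "a i \<noteq> 0" for i
    proof -
      consider "i = m" | "i = n" | "m < i" "i < n"
        using i assms(3) by (force simp: subset_iff le_less)
      then show ?thesis
      proof cases
        case 2
        then show ?thesis
          using sL by (simp add: L_def D_def)
      next
        case 3
        let ?v = "\<lambda>i. real (multiplicity (p j) (a i))"
        have "(?v i - ?v n) * (ln (real m) - ln (real i)) < (?v i - ?v m) * (ln (real n) - ln (real i))"
          using 3 j i am an m mn assms(9) by (intro nu_epowr_less_imp) auto
        \<comment> \<open>Substitute \<open>?v n = ?v m + D j\<close> and collect the terms with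
          \<open>?v i - ?v m\<close>.\<close>
        then have "of_int (D j) * (ln (real i) - ln (real m)) \<le> (?v i - ?v m) * L"
          by (simp add: D_def L_def algebra_simps)
        then have "s * (ln (real i) - ln (real m)) * L \<le> (?v i - ?v m) * L"
          unfolding sL[symmetric] by (simp add: mult_ac)
        then show ?thesis
          using L by simp
      qed simp
    qed
    have "real (multiplicity (p j) (g n1)) - real (multiplicity (p j) (g m1)) = s * L1"
      unfolding L1_def
    proof (rule factor_slope[OF p g g1(1,2) h h1(1,2) Pm Pn])
      show "real (multiplicity (p j) (g n1 * h n2)) - real (multiplicity (p j) (g m1 * h m2))
          = s * (ln (real (n1 * n2)) - ln (real (m1 * m2)))"
        using sL mult[OF am] mult[OF an]
        by (simp add: Pm[symmetric] Pn[symmetric] m_eq[symmetric] n_eq[symmetric] L_def D_def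
          del: of_nat_mult)
      show "s * (ln (real i) - ln (real (m1 * m2))) \<le> real (multiplicity (p j) (dirichlet_prod g h i))
          - real (multiplicity (p j) (g m1 * h m2))" if "dirichlet_prod g h i \<noteq> 0" for i
      proof -
        have "a i \<noteq> 0"
          using that by (auto simp: gh)
        then show ?thesis
          using above[of i] mult[of i] mult[OF am]
          by (simp add: Pm[symmetric] m_eq[symmetric] del: of_nat_mult)
      qed
    qed
    then have "of_int (E j) * L = s * L1 * L"
      by (simp add: E_def)
    also have "\<dots> = s * L * L1"
      by simp
    finally show ?thesis
      using sL by simp
  qed
  have one: "1 \<in> {1..t}"
    using assms(6) by simp
  have D1: "D 1 \<noteq> 0"
    using bspec[OF assms(8) one] am an by (simp add: nu_def D_def)
  have L1_nonneg: "0 \<le> L1"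
    using g1(3,4) by (simp add: L1_def)
  \<comment> \<open>The slope relation at \<open>j = 1\<close> gives L1 / L = e / d, where
    \<open>d\<close> is nonzero by (i). Absolute values are harmless because both lengths are
    nonnegative.\<close>
  define d where "d = nat \<bar>D 1\<bar>"
  define e where "e = nat \<bar>E 1\<bar>"
  have d: "d \<noteq> 0"
    using D1 by (simp add: d_def)
  have de: "real d * L1 = real e * L"
    using arg_cong[OF slope[OF one], of abs] L L1_nonneg by (simp add: d_def e_def abs_mult)
  have "int d dvd int e * x"
    if "x \<in> D ` {1..t} \<union> (\<lambda>q. int (multiplicity q n) - int (multiplicity q m)) ` prime_factors (m * n)"
    for x
    using that
  proof (elim UnE imageE)
    fix j assume x: "x = D j" and j: "j \<in> {1..t}"
    \<comment> \<open>The ratio L1 / L is the same for every \<open>j\<close>, so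
      \<open>real d * L1\<close> may be replaced by \<open>real e * L\<close> in the relation at
      \<open>p j\<close>.\<close>
    have "real_of_int (int d * E j) * L = of_int (D j) * (real d * L1)"
      using slope[OF j] by simp
    also have "\<dots> = real_of_int (int e * D j) * L"
      unfolding de by simp
    finally have "int d * E j = int e * D j"
      using L by (metis less_irrefl mult_cancel_right of_int_eq_iff)
    then show ?thesis
      unfolding x by (metis dvd_triv_left)
  next
    fix q assume x: "x = int (multiplicity q n) - int (multiplicity q m)"
      and q: "q \<in> prime_factors (m * n)"
    have "int d * (int (multiplicity q n1) - int (multiplicity q m1)) = int e * x"
      unfolding x using de m mn g1(3) n12 q
      by (intro multiplicity_diff_of_ln_ratio) (auto simp: L_def L1_def)
    then show ?thesis
      by (metis dvd_triv_left)
  qed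
  \<comment> \<open>A common divisor of all products \<open>int e * x\<close> divides
    \<open>int e\<close> times the gcd of the \<open>x\<close>, which is 1 by (iii). So the ratio L1
    / L is an integer.\<close>
  then have "int d dvd Gcd ((*) (int e) ` (D ` {1..t} \<union>
      (\<lambda>q. int (multiplicity q n) - int (multiplicity q m)) ` prime_factors (m * n)))"
    by (intro Gcd_greatest) auto
  moreover have "D = (\<lambda>j. int (multiplicity (p j) (a n)) - int (multiplicity (p j) (a m)))"
    by (simp add: D_def fun_eq_iff)
  ultimately have "int d dvd int e"
    using assms(10) by (simp only: Gcd_mult) simp
  then obtain u where u: "e = d * u"
    by auto
  have L1u: "L1 = real u * L"
    using de d unfolding u by simp
  \<comment> \<open>The lengths of the two factors add up to \<open>L\<close>, and that of
    \<open>h\<close> is nonnegative, so the integer \<open>u\<close> is at most 1.\<close>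
  have L2: "L - L1 = ln (real n2) - ln (real m2)"
    using g1(3) h1(3) n12 by (simp add: L_def L1_def m_eq n_eq ln_mult)
  have "L1 \<le> L"
  proof -
    have "ln (real m2) \<le> ln (real n2)"
      using h1(3,4) by simp
    then show ?thesis
      using L2 by linarith
  qed
  then have "u \<le> 1"
    using L unfolding L1u by simp
  then consider "u = 0" | "u = 1"
    by linarith
  \<comment> \<open>If \<open>u = 0\<close>, the segment of \<open>g\<close> has length 0; if
    \<open>u = 1\<close>, that of \<open>h\<close> does. The factor concerned then has a single
    index and is constant.\<close>
  then show False
  proof cases
    case 1
    then have "n1 = m1"
      using L1u g1(3) n12 by (simp add: L1_def)
    then show False
      using dirichlet_const_single[of g m1 m2 n2] nonconst(1) g1(5,6) assms(5) m_eq n_eq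
      by (metis antisym)
  next
    case 2
    then have "n2 = m2"
      using L1u L2 h1(3) n12 by simp
    then show False
      using dirichlet_const_single[of h m2 m1 n1] nonconst(2) h1(5,6) assms(5) m_eq n_eq
      by (metis antisym mult.commute)
  qed
qed

end
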